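(* Let $r > 1$ be an integer and let $\{X_{n}, \, n \geqslant 1\}$ be a sequence of random variables on a probability space $(\Omega,\mathcal{F},\mathbb{P})$ with $\mathbb{E}\lvert X_{n}\rvert < \infty$ for all $n$. Let $\{b_{n}\}_{n\geqslant 1}$ be a nondecreasing sequence of positive constants and let $\{a_{n,k}, \, 1 \leqslant k \leqslant n+1, \, n \geqslant 1\}$ be an array of positive constants such that (a) $\displaystyle \sum_{k=1}^{n+1} a_{n,k} = O(b_{r^{n}})$ as $n \to \infty$; (b) $\displaystyle \sum_{k=1}^{n+1} \ \max_{0 \leqslant h < r^{n-k+1}} \ \sum_{j=1+hr^{k}}^{hr^{k}+r^{k}} \mathbb{E}\lvert X_{j}\rvert I_{\{\lvert X_{j}\rvert > b_{r^{k-1}}\}} = o(b_{r^{n}})$ as $n \to \infty$. Then, for any $\varepsilon > 0$, there are a positive integer $n_{0}$ and a constant $C(r) > 0$ such that, for all $n \geqslant n_{0}$, $$ \begin{aligned} &\mathbb{P}\left\{\max_{1 \leqslant m < r^{n+1}} \left\lvert \sum_{k=1}^{m}(X_{k} - \mathbb{E} X_{k})\right\rvert > \varepsilon b_{r^{n}}\right\} \\ &\quad \leqslant \sum_{k=1}^{r^{n+1}-1} \mathbb{P}\{\lvert X_{k}\rvert > b_{r^{n+1}}\} + \frac{C(r)}{\varepsilon^{2}} \sum_{k=1}^{n+1}\sum_{j=1}^{r^{n+1}} a_{n,k}^{-2}\left(\mathbb{E} X_{j}^{2} I_{\{\lvert X_{j}\rvert \leqslant b_{r^{k}}\}} + b_{r^{k}}^{2}\,\mathbb{P}\{\lvert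 X_{j}\rvert > b_{r^{k-1}}\}\right) \\ &\qquad + \frac{C(r)}{\varepsilon^{2}} \sum_{k=1}^{n+1} a_{n,k}^{-2} \max_{1 \leqslant \ell \leqslant r-1} \sum_{h=0}^{r^{n-k+1}-1}\left[\sum_{1+hr^{k} \leqslant i < j \leqslant hr^{k}+\ell r^{k-1}} G_{X_{i},X_{j}}(b_{r^{k-1}})\right]^{+} \\ &\qquad + \frac{C(r)}{\varepsilon^{2}} \sum_{k=1}^{n+1} a_{n,k}^{-2} \sum_{h=0}^{r^{n-k+1}-1}\left[\sum_{1+hr^{k} \leqslant i < j \leqslant hr^{k}+r^{k}} H_{X_{i},X_{j}}(b_{r^{k-1}},b_{r^{k}})\right]^{+}. \end{aligned} $$
   Context: Notation: $x\wedge y=\min\{x,y\}$, $x\vee y=\max\{x,y\}$, $x^{+}=0\vee x$; $I_{A}$ is the indicator of the event $A$. $C(r)$ denotes a positive constant depending on $r$ (it does not depend on $n$). No dependence structure is assumed on the random variables. For real numbers $0<L\leqslant K$, define the truncation $g_{L}(t)=(t\wedge L)\vee(-L)$ and $h_{L,K}(t)=\lvert g_{K}(t)-g_{L}(t)\rvert$. For random variables $X,Y$, define $$G_{X,Y}(L):=\mathrm{Cov}\big(g_{L}(X),g_{L}(Y)\big),\qquad H_{X,Y}(L,K):=\mathrm{Cov}\big(h_{L,K}(X),h_{L,K}(Y)\big).$$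
   Formalization: The constant C(r) depends on r and also on the implied constant in the O-bound of condition (a), because a constant depending on r alone is impossible (rescaling the array a_{n,k} keeps (a) and (b)); it does not depend on ε, n or the random variables. *)

theory Defs
  imports "HOL-Probability.Probability" "HOL-Library.Landau_Symbols"
begin

definition covariance :: "'a measure \<Rightarrow> ('a \<Rightarrow> real) \<Rightarrow> ('a \<Rightarrow> real) \<Rightarrow> real" where
  "covariance M U V =
     (LINT \<omega>|M. (U \<omega> - (LINT \<omega>'|M. U \<omega>')) * (V \<omega> - (LINT \<omega>'|M. V \<omega>')))"

definition trunc :: "real \<Rightarrow> real \<Rightarrow> real" where
  "trunc L t = max (min t L) (- L)"

definition trunc_gap :: "real \<Rightarrow> real \<Rightarrow> real \<Rightarrow> real" where
  "trunc_gap L K t = \<bar>trunc K t - trunc L t\<bar>"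

definition G_cov :: "'a measure \<Rightarrow> ('a \<Rightarrow> real) \<Rightarrow> ('a \<Rightarrow> real) \<Rightarrow> real \<Rightarrow> real" where
  "G_cov M U V L = covariance M (\<lambda>\<omega>. trunc L (U \<omega>)) (\<lambda>\<omega>. trunc L (V \<omega>))"

definition H_cov :: "'a measure \<Rightarrow> ('a \<Rightarrow> real) \<Rightarrow> ('a \<Rightarrow> real) \<Rightarrow> real \<Rightarrow> real \<Rightarrow> real" where
  "H_cov M U V L K =
     covariance M (\<lambda>\<omega>. trunc_gap L K (U \<omega>)) (\<lambda>\<omega>. trunc_gap L K (V \<omega>))"

definition pos_part :: "real \<Rightarrow> real" where
  "pos_part x = max 0 x"

end

theory Submission
  imports Defs
begin

text \<open>
  The proof is a chaining argument along the base-\<open>r\<close> digits of the summation index, with the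
  truncation level tied to the scale. Put \<open>N = n + 1\<close>, \<open>\<beta>\<^sub>k = b (r\<^sup>k)\<close>, and for \<open>m < r\<^sup>N\<close> let
  \<open>m\<^sub>k\<close> be the largest multiple of \<open>r\<^sup>k\<close> not exceeding \<open>m\<close>, so that \<open>m\<^sub>N = 0\<close> and \<open>m\<^sub>0 = m\<close>.
  Unless some variable exceeds \<open>\<beta>\<^sub>N\<close>, which accounts for the first sum of the bound, the variables
  may be replaced by their truncations at \<open>\<beta>\<^sub>N\<close>. Their sum up to \<open>m\<close> splits into one contribution
  per scale \<open>k\<close> (\<open>base_chaining_identity\<close>): the sum over \<open>m\<^sub>k < j \<le> m\<^bsub>k-1\<^esub>\<close> of the truncations
  at \<open>\<beta>\<^bsub>k-1\<^esub>\<close>, and the sum over \<open>m\<^sub>k < j \<le> m\<close> of the increments from level \<open>\<beta>\<^bsub>k-1\<^esub>\<close> to level \<open>\<beta>\<^sub>k\<close>.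

  The gain is that at scale \<open>k\<close> few different sums occur. The first kind runs over one of
  \<open>r\<^bsup>N-k\<^esup>(r - 1)\<close> initial segments of \<open>r\<close>-adic blocks. The second kind has an arbitrary endpoint,
  but absolute values can be taken inside, and then the whole block of length \<open>r\<^sup>k\<close> dominates it;
  the price is the mean of the absolute increments, counted twice, which condition (b) makes
  negligible. This pathwise estimate is \<open>chaining_bound\<close>.

  Condition (a) distributes the level \<open>\<epsilon> b (r\<^sup>n)\<close> over the scales in proportion to the weights
  \<open>a\<^bsub>n,k\<^esub>\<close>. If the maximum is large, one of the finitely many block sums exceeds its share, and
  Chebyshev's inequality (\<open>chebyshev_sum_covariances\<close>) with a union bound gives the remaining
  terms: variances contribute truncated second moments, and the off-diagonal covariances are
  bounded by their positive part, since no sign is known. This is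
  \<open>multiscale_maximal_inequality\<close>; the theorem is the choice of thresholds in it.
\<close>

section \<open>Splitting sums along base-r digits\<close>

text \<open>
  The induction on \<open>N\<close> peels off the coarsest scale: on the part above \<open>m\<^sub>N\<close> the level \<open>N\<close> is lowered
  to \<open>N - 1\<close> at the cost of the increments, and the range down to \<open>m\<^bsub>N-1\<^esub>\<close> is then complete.
  When \<open>m < r ^ N\<close> the left-hand side is the full sum up to \<open>m\<close>.
\<close>

lemma base_chaining_identity:
  fixes y :: "nat \<Rightarrow> nat \<Rightarrow> real" and r m N :: nat
  shows "(\<Sum>j\<in>{m div r ^ N * r ^ N<..m}. y N j) =
    (\<Sum>k=1..N. (\<Sum>j\<in>{m div r ^ k * r ^ k<..m div r ^ (k - 1) * r ^ (k - 1)}. y (k - 1) j)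
             + (\<Sum>j\<in>{m div r ^ k * r ^ k<..m}. y k j - y (k - 1) j))"
proof (induction N)
  case 0
  then show ?case by simp
next
  case (Suc N)
  let ?p = "m div r ^ Suc N * r ^ Suc N" and ?q = "m div r ^ N * r ^ N"
  have le1: "?q \<le> m" by (simp add: div_times_less_eq_dividend)
  have "m div r ^ Suc N = m div r ^ N div r"
    by (simp only: power_Suc2 div_mult2_eq)
  then have "?p = m div r ^ N div r * r * r ^ N" by simp
  also have "\<dots> \<le> m div r ^ N * r ^ N"
    by (intro mult_right_mono) (auto simp: div_times_less_eq_dividend)
  finally have le2: "?p \<le> ?q" .
  have un: "{?p<..m} = {?p<..?q} \<union> {?q<..m}" using ivl_disj_un_two(6)[OF le2 le1] by (rule sym)
  have "(\<Sum>j\<in>{?p<..m}. y N j) = (\<Sum>j\<in>{?p<..?q}. y N j) + (\<Sum>j\<in>{?q<..m}. y N j)"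
    unfolding un by (intro sum.union_disjoint) auto
  then have "(\<Sum>j\<in>{?p<..m}. y (Suc N) j) =
      (\<Sum>j\<in>{?p<..?q}. y N j) + (\<Sum>j\<in>{?p<..m}. y (Suc N) j - y N j) + (\<Sum>j\<in>{?q<..m}. y N j)"
    by (simp add: sum_subtractf)
  then show ?case using Suc.IH by simp
qed

lemma square_sum_eq_diagonal_plus_pairs:
  fixes x :: "nat \<Rightarrow> real" and s t :: nat
  shows "(\<Sum>j=s..t. x j)\<^sup>2 =
    (\<Sum>j=s..t. (x j)\<^sup>2) + 2 * (\<Sum>(i, j)\<in>{(i, j). s \<le> i \<and> i < j \<and> j \<le> t}. x i * x j)"
proof -
  let ?U = "{(i, j). s \<le> i \<and> i < j \<and> j \<le> t}" and ?D = "(\<lambda>j. (j, j)) ` {s..t}"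
  let ?f = "\<lambda>(i, j). x i * x j"
  have finU: "finite ?U" by (rule finite_subset[of _ "{s..t} \<times> {s..t}"]) auto
  have sq: "{s..t} \<times> {s..t} = (?D \<union> ?U) \<union> prod.swap ` ?U"
  proof (intro equalityI subsetI)
    fix p assume "p \<in> {s..t} \<times> {s..t}"
    then obtain i j where p: "p = (i, j)" "s \<le> i" "i \<le> t" "s \<le> j" "j \<le> t" by auto
    consider "i = j" | "i < j" | "j < i" by linarith
    then show "p \<in> (?D \<union> ?U) \<union> prod.swap ` ?U"
    proof cases
      case 3
      then have "p = prod.swap (j, i)" "(j, i) \<in> ?U" using p by auto
      then show ?thesis by blast
    qed (use p in auto)
  qed auto
  have "(\<Sum>j=s..t. x j)\<^sup>2 = sum ?f ({s..t} \<times> {s..t})"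
    by (simp add: power2_eq_square sum_product sum.cartesian_product)
  also have "\<dots> = sum ?f (?D \<union> ?U) + sum ?f (prod.swap ` ?U)"
    unfolding sq by (intro sum.union_disjoint) (use finU in auto)
  also have "sum ?f (?D \<union> ?U) = sum ?f ?D + sum ?f ?U"
    by (intro sum.union_disjoint) (use finU in auto)
  also have "sum ?f ?D = (\<Sum>j=s..t. (x j)\<^sup>2)"
    by (subst sum.reindex) (auto simp: inj_on_def power2_eq_square)
  also have "sum ?f (prod.swap ` ?U) = sum ?f ?U"
    by (subst sum.reindex) (auto simp: mult.commute intro!: sum.cong)
  finally show ?thesis by simp
qed

text \<open>
  Initial segments of consecutive blocks of length \<open>p\<close> are disjoint, so one segment per block
  never counts an index twice.
\<close>

lemma sum_initial_segments_of_blocks_le: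
  fixes f :: "nat \<Rightarrow> real" and p q t :: nat
  assumes "t \<le> p" and nonneg: "\<And>j. f j \<ge> 0"
  shows "(\<Sum>h<q. \<Sum>j=1 + h * p..h * p + t. f j) \<le> (\<Sum>j=1..q * p. f j)"
proof (induction q)
  case 0
  then show ?case by simp
next
  case (Suc q)
  have "{1..Suc q * p} = {1..q * p} \<union> {1 + q * p..q * p + p}" by auto
  then have "(\<Sum>j=1..Suc q * p. f j) = (\<Sum>j=1..q * p. f j) + (\<Sum>j=1 + q * p..q * p + p. f j)"
    by (simp only:) (intro sum.union_disjoint; auto)
  moreover have "(\<Sum>j=1 + q * p..q * p + t. f j) \<le> (\<Sum>j=1 + q * p..q * p + p. f j)"
    by (intro sum_mono2) (use assms in auto)
  ultimately show ?case using Suc.IH by simp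
qed

section \<open>Truncation\<close>

lemma trunc_measurable [measurable]: "trunc L \<in> borel_measurable borel"
  unfolding trunc_def[abs_def] by measurable

lemma trunc_gap_measurable [measurable]: "trunc_gap L K \<in> borel_measurable borel"
  unfolding trunc_gap_def[abs_def] by measurable

lemma abs_trunc_le: "0 < L \<Longrightarrow> \<bar>trunc L t\<bar> \<le> L"
  by (auto simp: trunc_def)

lemma abs_trunc_gap_le: "0 < L \<Longrightarrow> L \<le> K \<Longrightarrow> \<bar>trunc_gap L K t\<bar> \<le> K"
  by (auto simp: trunc_def trunc_gap_def)

lemma abs_trunc_gap_le_abs: "0 < L \<Longrightarrow> L \<le> K \<Longrightarrow> \<bar>trunc_gap L K t\<bar> \<le> \<bar>t\<bar>"
  by (auto simp: trunc_def trunc_gap_def)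

lemma trunc_eq: "\<bar>t\<bar> \<le> L \<Longrightarrow> trunc L t = t"
  by (auto simp: trunc_def)

lemma trunc_gap_le_tail:
  "0 < L \<Longrightarrow> L \<le> K \<Longrightarrow> trunc_gap L K t \<le> \<bar>t\<bar> * of_bool (\<bar>t\<bar> > L)"
  by (auto simp: trunc_def trunc_gap_def)

lemma trunc_error_le_tail:
  "0 < L \<Longrightarrow> L \<le> K \<Longrightarrow> \<bar>trunc K t - t\<bar> \<le> \<bar>t\<bar> * of_bool (\<bar>t\<bar> > L)"
  by (auto simp: trunc_def)

text \<open>
  Applies both to \<open>trunc L t\<close> and to \<open>trunc_gap L K t\<close> in the role of \<open>u\<close>, so that a single
  moment functional controls both kinds of block sums.
\<close>

lemma square_le_truncated_square:
  fixes t u L K :: real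
  assumes "\<bar>u\<bar> \<le> \<bar>t\<bar>" and "\<bar>u\<bar> \<le> K" and "L \<le> K"
  shows "u\<^sup>2 \<le> t\<^sup>2 * of_bool (\<bar>t\<bar> \<le> K) + K\<^sup>2 * of_bool (\<bar>t\<bar> > L)"
proof (cases "\<bar>t\<bar> \<le> K")
  case True
  have "u\<^sup>2 \<le> t\<^sup>2" using assms(1) by (simp add: abs_le_square_iff)
  then show ?thesis using True by (simp add: add_increasing2)
next
  case False
  then have "u\<^sup>2 \<le> K\<^sup>2" using assms(2) by (intro abs_le_square_iff[THEN iffD1]) auto
  then show ?thesis using False assms(3) by simp
qed

definition tail_mean :: "'a measure \<Rightarrow> ('a \<Rightarrow> real) \<Rightarrow> real \<Rightarrow> real" where
  "tail_mean M U L = (LINT \<omega>|M. \<bar>U \<omega>\<bar> * indicator {\<omega>\<in>space M. \<bar>U \<omega>\<bar> > L} \<omega>)"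

text \<open>
  The levels mark where \<open>trunc_gap L K\<close> starts and where it saturates: it vanishes for arguments of size up to \<open>L\<close>,
  is at most the size of its argument up to \<open>K\<close>, and at most \<open>K\<close> beyond.
\<close>

definition truncated_moment :: "'a measure \<Rightarrow> ('a \<Rightarrow> real) \<Rightarrow> real \<Rightarrow> real \<Rightarrow> real" where
  "truncated_moment M U L K = (LINT \<omega>|M. (U \<omega>)\<^sup>2 * indicator {\<omega>\<in>space M. \<bar>U \<omega>\<bar> \<le> K} \<omega>)
     + K\<^sup>2 * \<P>(\<omega> in M. \<bar>U \<omega>\<bar> > L)"

lemma tail_mean_nonneg: "tail_mean M U L \<ge> 0"
  unfolding tail_mean_def by (intro integral_nonneg_AE) auto

lemma truncated_moment_nonneg: "truncated_moment M U L K \<ge> 0"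
  unfolding truncated_moment_def by (intro add_nonneg_nonneg integral_nonneg_AE) auto

lemma (in prob_space) abs_expectation_le_tail_mean:
  fixes U V :: "'a \<Rightarrow> real"
  assumes U: "integrable M U" and V: "integrable M V"
    and le: "\<And>\<omega>. \<omega> \<in> space M \<Longrightarrow> \<bar>V \<omega>\<bar> \<le> \<bar>U \<omega>\<bar> * of_bool (\<bar>U \<omega>\<bar> > L)"
  shows "\<bar>expectation V\<bar> \<le> tail_mean M U L"
proof -
  have [measurable]: "U \<in> borel_measurable M" using U by auto
  have int: "integrable M (\<lambda>\<omega>. \<bar>U \<omega>\<bar> * indicator {\<omega>\<in>space M. \<bar>U \<omega>\<bar> > L} \<omega>)"
    by (rule Bochner_Integration.integrable_bound[OF integrable_abs[OF U]])
       (auto split: split_indicator)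
  have "\<bar>expectation V\<bar> \<le> expectation (\<lambda>\<omega>. \<bar>V \<omega>\<bar>)"
    by (rule integral_abs_bound)
  also have "\<dots> \<le> tail_mean M U L"
    unfolding tail_mean_def
    by (intro integral_mono integrable_abs V int)
       (use le in \<open>auto simp: indicator_def of_bool_def split: if_splits\<close>)
  finally show ?thesis .
qed

lemma (in prob_space) expectation_square_le_truncated_moment:
  fixes U V :: "'a \<Rightarrow> real"
  assumes [measurable]: "U \<in> borel_measurable M" "V \<in> borel_measurable M"
    and "L \<le> K"
    and le: "\<And>\<omega>. \<bar>V \<omega>\<bar> \<le> \<bar>U \<omega>\<bar>" "\<And>\<omega>. \<bar>V \<omega>\<bar> \<le> K"
  shows "expectation (\<lambda>\<omega>. (V \<omega>)\<^sup>2) \<le> truncated_moment M U L K"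
proof -
  let ?A = "{\<omega>\<in>space M. \<bar>U \<omega>\<bar> \<le> K}" and ?B = "{\<omega>\<in>space M. \<bar>U \<omega>\<bar> > L}"
  have K: "0 \<le> K" using le(2)[of undefined] by linarith
  have sq: "(V \<omega>)\<^sup>2 \<le> K\<^sup>2" for \<omega>
    using le(2)[of \<omega>] K by (intro abs_le_square_iff[THEN iffD1]) auto
  have i1: "integrable M (\<lambda>\<omega>. (U \<omega>)\<^sup>2 * indicator ?A \<omega>)"
    by (rule integrable_const_bound[where B = "K\<^sup>2"])
       (use K in \<open>auto split: split_indicator simp: abs_le_square_iff[symmetric]\<close>)
  have i2: "integrable M (\<lambda>\<omega>. K\<^sup>2 * indicator ?B \<omega>)"
    by (rule integrable_const_bound[where B = "K\<^sup>2"]) (auto split: split_indicator)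
  have i3: "integrable M (\<lambda>\<omega>. (V \<omega>)\<^sup>2)"
    by (rule integrable_const_bound[where B = "K\<^sup>2"]) (use sq in auto)
  have "expectation (\<lambda>\<omega>. (V \<omega>)\<^sup>2) \<le> expectation (\<lambda>\<omega>. (U \<omega>)\<^sup>2 * indicator ?A \<omega> + K\<^sup>2 * indicator ?B \<omega>)"
  proof (intro integral_mono i3 Bochner_Integration.integrable_add i1 i2)
    fix \<omega> assume "\<omega> \<in> space M"
    then show "(V \<omega>)\<^sup>2 \<le> (U \<omega>)\<^sup>2 * indicator ?A \<omega> + K\<^sup>2 * indicator ?B \<omega>"
      using square_le_truncated_square[of "V \<omega>" "U \<omega>" K L] le[of \<omega>] \<open>L \<le> K\<close>
      by (simp add: indicator_def of_bool_def)
  qed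
  also have "\<dots> = truncated_moment M U L K"
    unfolding truncated_moment_def using i1 i2 by simp
  finally show ?thesis .
qed

section \<open>Chebyshev's inequality for dependent sums\<close>

text \<open>
  The variance of a sum is the sum of the variances plus twice the covariances of the pairs
  \<open>i < j\<close>. Without any assumption on the dependence the latter sum may have either sign; its positive
  part makes the bound a sum of nonnegative terms, whose coefficients may later be enlarged.
\<close>

lemma (in prob_space) chebyshev_sum_covariances:
  fixes U :: "nat \<Rightarrow> 'a \<Rightarrow> real" and s t :: nat and B c :: real and Q :: "nat \<Rightarrow> real"
  assumes meas: "\<And>j. s \<le> j \<Longrightarrow> U j \<in> borel_measurable M"
    and bd: "\<And>j \<omega>. \<bar>U j \<omega>\<bar> \<le> B"
    and Q: "\<And>j. s \<le> j \<Longrightarrow> expectation (\<lambda>\<omega>. (U j \<omega>)\<^sup>2) \<le> Q j"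
    and "c > 0"
  shows "\<P>(\<omega> in M. \<bar>\<Sum>j=s..t. U j \<omega> - expectation (U j)\<bar> > c)
    \<le> 1 / c\<^sup>2 * ((\<Sum>j=s..t. Q j)
        + 2 * pos_part (\<Sum>(i, j)\<in>{(i, j). s \<le> i \<and> i < j \<and> j \<le> t}. covariance M (U i) (U j)))"
proof -
  let ?P = "{(i, j). s \<le> i \<and> i < j \<and> j \<le> t}"
  let ?V = "\<lambda>j \<omega>. U j \<omega> - expectation (U j)" and ?S = "\<lambda>\<omega>. \<Sum>j=s..t. U j \<omega> - expectation (U j)"
  have intU: "integrable M (U j)" if "s \<le> j" for j
    by (rule integrable_const_bound[where B = B]) (use bd meas that in auto)
  have intU2: "integrable M (\<lambda>\<omega>. U i \<omega> * U j \<omega>)" if "s \<le> i" "s \<le> j" for i j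
    by (rule integrable_const_bound[where B = "B * B"])
       (use meas that in \<open>auto simp: abs_mult intro!: mult_mono bd order_trans[OF abs_ge_zero bd]\<close>)
  have intV2: "integrable M (\<lambda>\<omega>. ?V i \<omega> * ?V j \<omega>)" if "s \<le> i" "s \<le> j" for i j
    using intU[OF that(1)] intU[OF that(2)] intU2[OF that]
    by (simp add: algebra_simps)
  have sqeq: "(?S \<omega>)\<^sup>2 = (\<Sum>j=s..t. ?V j \<omega> * ?V j \<omega>) + 2 * (\<Sum>p\<in>?P. ?V (fst p) \<omega> * ?V (snd p) \<omega>)" for \<omega>
    using square_sum_eq_diagonal_plus_pairs[of "\<lambda>j. ?V j \<omega>" s t]
    by (simp add: power2_eq_square case_prod_beta)
  have int1: "integrable M (\<lambda>\<omega>. \<Sum>j=s..t. ?V j \<omega> * ?V j \<omega>)"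
    by (intro Bochner_Integration.integrable_sum intV2) auto
  have int2: "integrable M (\<lambda>\<omega>. \<Sum>p\<in>?P. ?V (fst p) \<omega> * ?V (snd p) \<omega>)"
    by (intro Bochner_Integration.integrable_sum intV2) auto
  have intS: "integrable M (\<lambda>\<omega>. (?S \<omega>)\<^sup>2)"
    unfolding sqeq using int1 int2 by auto
  have e1: "expectation (\<lambda>\<omega>. \<Sum>j=s..t. ?V j \<omega> * ?V j \<omega>) \<le> (\<Sum>j=s..t. Q j)"
  proof -
    have "expectation (\<lambda>\<omega>. \<Sum>j=s..t. ?V j \<omega> * ?V j \<omega>) = (\<Sum>j=s..t. expectation (\<lambda>\<omega>. ?V j \<omega> * ?V j \<omega>))"
      by (intro Bochner_Integration.integral_sum intV2) auto
    also have "\<dots> \<le> (\<Sum>j=s..t. Q j)"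
    proof (intro sum_mono)
      fix j assume "j \<in> {s..t}"
      then have j: "s \<le> j" by simp
      have "expectation (\<lambda>\<omega>. ?V j \<omega> * ?V j \<omega>) = variance (U j)"
        by (simp add: power2_eq_square)
      also have "\<dots> = expectation (\<lambda>\<omega>. (U j \<omega>)\<^sup>2) - (expectation (U j))\<^sup>2"
        by (rule variance_eq) (use intU intU2 j in \<open>auto simp: power2_eq_square\<close>)
      also have "\<dots> \<le> Q j"
        using Q[OF j] by (smt (verit) zero_le_power2)
      finally show "expectation (\<lambda>\<omega>. ?V j \<omega> * ?V j \<omega>) \<le> Q j" .
    qed
    finally show ?thesis .
  qed
  have e2: "expectation (\<lambda>\<omega>. \<Sum>p\<in>?P. ?V (fst p) \<omega> * ?V (snd p) \<omega>)
      = (\<Sum>(i, j)\<in>?P. covariance M (U i) (U j))"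
    by (subst Bochner_Integration.integral_sum)
       (auto simp: covariance_def case_prod_beta intro!: intV2 sum.cong)
  have "expectation (\<lambda>\<omega>. (?S \<omega>)\<^sup>2)
      \<le> (\<Sum>j=s..t. Q j) + 2 * (\<Sum>(i, j)\<in>?P. covariance M (U i) (U j))"
    unfolding sqeq using e1 e2 int1 int2 by simp
  also have "\<dots> \<le> (\<Sum>j=s..t. Q j) + 2 * pos_part (\<Sum>(i, j)\<in>?P. covariance M (U i) (U j))"
    by (simp add: pos_part_def)
  finally have var: "expectation (\<lambda>\<omega>. (?S \<omega>)\<^sup>2) \<le> \<dots>" .
  have [measurable]: "?S \<in> borel_measurable M"
    by (intro borel_measurable_sum borel_measurable_diff meas) auto
  have "\<P>(\<omega> in M. \<bar>?S \<omega>\<bar> > c) \<le> \<P>(\<omega> in M. (?S \<omega>)\<^sup>2 \<ge> c\<^sup>2)"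
  proof (rule finite_measure_mono)
    show "{\<omega>\<in>space M. \<bar>?S \<omega>\<bar> > c} \<subseteq> {\<omega>\<in>space M. (?S \<omega>)\<^sup>2 \<ge> c\<^sup>2}"
      using \<open>c > 0\<close> by (auto simp: abs_le_square_iff[symmetric])
  qed measurable
  also have "\<dots> \<le> expectation (\<lambda>\<omega>. (?S \<omega>)\<^sup>2) / c\<^sup>2"
    by (rule integral_Markov_inequality_measure[where A = "space M"])
       (use intS \<open>c > 0\<close> in auto)
  also have "\<dots> \<le> 1 / c\<^sup>2 * ((\<Sum>j=s..t. Q j)
        + 2 * pos_part (\<Sum>(i, j)\<in>?P. covariance M (U i) (U j)))"
    using var by (simp add: divide_right_mono)
  finally show ?thesis .
qed

section \<open>The pathwise chaining estimate\<close>

text \<open>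
  The probabilistic input is reduced to numbers here. In the application \<open>x j\<close> is the value of the \<open>j\<close>th variable at one
  sample point, \<open>ex j\<close> its mean, \<open>e k j\<close> the mean of its truncation at \<open>\<beta> k\<close>, \<open>g k j\<close> the mean of
  the gap between levels \<open>k - 1\<close> and \<open>k\<close>, and \<open>\<tau> k j\<close> the tail mean above \<open>\<beta> (k - 1)\<close>.

  Each scale costs \<open>2 * \<alpha> k\<close>, once for the digit block and once for the gap block, and two tail means
  for recentring the gaps. The third copy of the tail means pays for replacing the mean of \<open>x j\<close> by
  that of its truncation at the top level.
\<close>

lemma chaining_bound:
  fixes x ex \<alpha> \<beta> :: "nat \<Rightarrow> real" and e g \<tau> :: "nat \<Rightarrow> nat \<Rightarrow> real" and r N m :: nat
  assumes "r > 1" and "N \<ge> 1" and m: "1 \<le> m" "m < r ^ N"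
    and x: "\<And>j. 1 \<le> j \<Longrightarrow> j < r ^ N \<Longrightarrow> \<bar>x j\<bar> \<le> \<beta> N"
    and digit_blocks: "\<And>k h l. k \<in> {1..N} \<Longrightarrow> h < r ^ (N - k) \<Longrightarrow> l \<in> {1..r - 1} \<Longrightarrow>
      \<bar>\<Sum>j=1 + h * r ^ k..h * r ^ k + l * r ^ (k - 1). trunc (\<beta> (k - 1)) (x j) - e (k - 1) j\<bar> \<le> \<alpha> k"
    and gap_blocks: "\<And>k h. k \<in> {1..N} \<Longrightarrow> h < r ^ (N - k) \<Longrightarrow>
      \<bar>\<Sum>j=1 + h * r ^ k..h * r ^ k + r ^ k. trunc_gap (\<beta> (k - 1)) (\<beta> k) (x j) - g k j\<bar> \<le> \<alpha> k"
    and \<alpha>: "\<And>k. k \<in> {1..N} \<Longrightarrow> 0 < \<alpha> k"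
    and e_g: "\<And>k j. k \<in> {1..N} \<Longrightarrow> 1 \<le> j \<Longrightarrow> \<bar>e k j - e (k - 1) j\<bar> \<le> g k j"
    and g_\<tau>: "\<And>k j. k \<in> {1..N} \<Longrightarrow> 1 \<le> j \<Longrightarrow> g k j \<le> \<tau> k j"
    and e_ex: "\<And>j. 1 \<le> j \<Longrightarrow> \<bar>e N j - ex j\<bar> \<le> \<tau> N j"
    and \<tau>: "\<And>k j. 0 \<le> \<tau> k j"
  shows "\<bar>\<Sum>j=1..m. x j - ex j\<bar> \<le> 2 * (\<Sum>k=1..N. \<alpha> k)
    + 3 * (\<Sum>k=1..N. MAX h\<in>{0..<r ^ (N - k)}. \<Sum>j=1 + h * r ^ k..h * r ^ k + r ^ k. \<tau> k j)"
proof -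
  define W where "W k = (MAX h\<in>{0..<r ^ (N - k)}. \<Sum>j=1 + h * r ^ k..h * r ^ k + r ^ k. \<tau> k j)" for k
  define u where "u k j = trunc (\<beta> k) (x j) - e k j" for k j
  have block_W: "(\<Sum>j=1 + h * r ^ k..h * r ^ k + r ^ k. \<tau> k j) \<le> W k" if "h < r ^ (N - k)" for h k
    unfolding W_def by (rule Max_ge) (use that in auto)
  have W0: "0 \<le> W k" for k
  proof -
    have "0 \<le> (\<Sum>j=1 + 0 * r ^ k..0 * r ^ k + r ^ k. \<tau> k j)" by (intro sum_nonneg \<tau>)
    also have "\<dots> \<le> W k" by (rule block_W) (use \<open>r > 1\<close> in simp)
    finally show ?thesis .
  qed
  have replaced: "\<bar>\<Sum>j=1..m. x j - ex j\<bar> \<le> \<bar>\<Sum>j=1..m. u N j\<bar> + W N"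
  proof -
    have "(\<Sum>j=1..m. x j - ex j) = (\<Sum>j=1..m. u N j + (e N j - ex j))"
    proof (intro sum.cong refl)
      fix j assume "j \<in> {1..m}"
      then have "\<bar>x j\<bar> \<le> \<beta> N" using m by (intro x) auto
      then show "x j - ex j = u N j + (e N j - ex j)" by (simp add: u_def trunc_eq)
    qed
    also have "\<bar>\<dots>\<bar> \<le> \<bar>\<Sum>j=1..m. u N j\<bar> + \<bar>\<Sum>j=1..m. e N j - ex j\<bar>"
      unfolding sum.distrib by (rule abs_triangle_ineq)
    also have "\<bar>\<Sum>j=1..m. e N j - ex j\<bar> \<le> (\<Sum>j=1..m. \<tau> N j)"
      by (rule order_trans[OF sum_abs sum_mono]) (use e_ex in auto)
    also have "(\<Sum>j=1..m. \<tau> N j) \<le> (\<Sum>j=1 + 0 * r ^ N..0 * r ^ N + r ^ N. \<tau> N j)"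
      by (intro sum_mono2) (use m \<tau> in auto)
    also have "\<dots> \<le> W N" by (rule block_W) simp
    finally show ?thesis by simp
  qed
  have level: "\<bar>(\<Sum>j\<in>{m div r ^ k * r ^ k<..m div r ^ (k - 1) * r ^ (k - 1)}. u (k - 1) j)
      + (\<Sum>j\<in>{m div r ^ k * r ^ k<..m}. u k j - u (k - 1) j)\<bar> \<le> 2 * \<alpha> k + 2 * W k"
    if k: "k \<in> {1..N}" for k
  proof -
    (* m lies in block h of length r ^ k, and l is its digit of weight r ^ (k - 1). *)
    define h where "h = m div r ^ k"
    define l where "l = m div r ^ (k - 1) mod r"
    have rk: "r ^ k = r ^ (k - 1) * r"
      using k by (cases k) auto
    have "m < r ^ (N - k) * r ^ k"
      using k m by (simp add: power_add[symmetric])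
    then have h: "h < r ^ (N - k)" unfolding h_def by (rule less_mult_imp_div_less)
    have "l < r" unfolding l_def using \<open>r > 1\<close> by simp
    have "h = m div r ^ (k - 1) div r"
      unfolding h_def rk by (rule div_mult2_eq)
    then have "m div r ^ (k - 1) = h * r + l"
      unfolding l_def by simp
    then have mk: "m div r ^ (k - 1) * r ^ (k - 1) = h * r ^ k + l * r ^ (k - 1)"
      by (simp add: rk algebra_simps)
    have "m mod r ^ k < r ^ k" using \<open>r > 1\<close> by simp
    then have m_le: "m \<le> h * r ^ k + r ^ k"
      unfolding h_def using div_mult_mod_eq[of m "r ^ k"] by linarith
    have 1: "\<bar>\<Sum>j\<in>{h * r ^ k<..h * r ^ k + l * r ^ (k - 1)}. u (k - 1) j\<bar> \<le> \<alpha> k"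
    (* The hypothesis on digit blocks starts at l = 1; a zero digit gives an empty sum. *)
    proof (cases "l = 0")
      case True
      then show ?thesis using \<alpha>[OF k] by simp
    next
      case False
      then have "l \<in> {1..r - 1}" using \<open>l < r\<close> by auto
      from digit_blocks[OF k h this] show ?thesis
        by (simp add: u_def atLeastSucAtMost_greaterThanAtMost)
    qed
    (* The terms become nonnegative before the range is enlarged to the whole block, which
       removes the dependence on m; recentring afterwards costs a second copy of g. *)
    have "\<bar>\<Sum>j\<in>{h * r ^ k<..m}. u k j - u (k - 1) j\<bar>
        \<le> (\<Sum>j\<in>{h * r ^ k<..m}. trunc_gap (\<beta> (k - 1)) (\<beta> k) (x j) + g k j)"
    proof (rule order_trans[OF sum_abs sum_mono])
      fix j assume "j \<in> {h * r ^ k<..m}"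
      then show "\<bar>u k j - u (k - 1) j\<bar> \<le> trunc_gap (\<beta> (k - 1)) (\<beta> k) (x j) + g k j"
        using e_g[OF k, of j] by (simp add: u_def trunc_gap_def)
    qed
    also have "\<dots> \<le> (\<Sum>j=1 + h * r ^ k..h * r ^ k + r ^ k. trunc_gap (\<beta> (k - 1)) (\<beta> k) (x j) + g k j)"
    proof (intro sum_mono2)
      fix j assume "j \<in> {1 + h * r ^ k..h * r ^ k + r ^ k} - {h * r ^ k<..m}"
      then have "0 \<le> g k j" using e_g[OF k, of j] by auto
      then show "0 \<le> trunc_gap (\<beta> (k - 1)) (\<beta> k) (x j) + g k j" by (simp add: trunc_gap_def)
    qed (use m_le in auto)
    also have "\<dots> = (\<Sum>j=1 + h * r ^ k..h * r ^ k + r ^ k. trunc_gap (\<beta> (k - 1)) (\<beta> k) (x j) - g k j)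
        + 2 * (\<Sum>j=1 + h * r ^ k..h * r ^ k + r ^ k. g k j)"
      by (simp add: sum.distrib sum_subtractf)
    also have "\<dots> \<le> \<alpha> k + 2 * W k"
    proof -
      have "(\<Sum>j=1 + h * r ^ k..h * r ^ k + r ^ k. g k j) \<le> (\<Sum>j=1 + h * r ^ k..h * r ^ k + r ^ k. \<tau> k j)"
        by (intro sum_mono g_\<tau> k) auto
      then show ?thesis using gap_blocks[OF k h] block_W[OF h] by linarith
    qed
    finally have 2: "\<bar>\<Sum>j\<in>{h * r ^ k<..m}. u k j - u (k - 1) j\<bar> \<le> \<alpha> k + 2 * W k" .
    show ?thesis
      unfolding mk h_def[symmetric] using 1 2 by linarith
  qed
  have "(\<Sum>j=1..m. u N j) = (\<Sum>j\<in>{m div r ^ N * r ^ N<..m}. u N j)"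
    using m by (simp add: atLeastSucAtMost_greaterThanAtMost)
  also have "\<bar>\<dots>\<bar> \<le> (\<Sum>k=1..N. 2 * \<alpha> k + 2 * W k)"
    unfolding base_chaining_identity by (rule order_trans[OF sum_abs sum_mono]) (rule level)
  finally have "\<bar>\<Sum>j=1..m. u N j\<bar> \<le> 2 * (\<Sum>k=1..N. \<alpha> k) + 2 * (\<Sum>k=1..N. W k)"
    by (simp add: sum.distrib sum_distrib_left)
  moreover have "W N \<le> (\<Sum>k=1..N. W k)"
    by (rule member_le_sum) (use W0 \<open>N \<ge> 1\<close> in auto)
  ultimately show ?thesis
    using replaced unfolding W_def by linarith
qed

section \<open>The maximal inequality over all scales\<close>

text \<open>
  By \<open>chaining_bound\<close>, the maximum can exceed \<open>T\<close> only if some variable exceeds the top level or some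
  centred block sum at some scale \<open>k\<close> exceeds \<open>\<alpha> k\<close>. The factor \<open>r\<close> arises at each scale from the
  \<open>r - 1\<close> possible digits together with the one family of gap blocks.
\<close>

lemma (in prob_space) multiscale_maximal_inequality:
  fixes X :: "nat \<Rightarrow> 'a \<Rightarrow> real" and \<alpha> \<beta> :: "nat \<Rightarrow> real" and r N :: nat and T :: real
  assumes r: "r > 1" and N: "N \<ge> 1"
    and X: "\<And>j. 1 \<le> j \<Longrightarrow> integrable M (X j)"
    and \<beta>: "\<And>k. k \<le> N \<Longrightarrow> 0 < \<beta> k" "\<And>k. k \<in> {1..N} \<Longrightarrow> \<beta> (k - 1) \<le> \<beta> k"
    and \<alpha>: "\<And>k. k \<in> {1..N} \<Longrightarrow> 0 < \<alpha> k"
    and T: "2 * (\<Sum>k=1..N. \<alpha> k) + 3 * (\<Sum>k=1..N. MAX h\<in>{0..<r ^ (N - k)}.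
        \<Sum>j=1 + h * r ^ k..h * r ^ k + r ^ k. tail_mean M (X j) (\<beta> (k - 1))) \<le> T"
  shows "\<P>(\<omega> in M. (MAX m\<in>{1..<r ^ N}. \<bar>\<Sum>j=1..m. X j \<omega> - expectation (X j)\<bar>) > T)
    \<le> (\<Sum>j=1..r ^ N - 1. \<P>(\<omega> in M. \<bar>X j \<omega>\<bar> > \<beta> N))
      + (\<Sum>k=1..N. 1 / (\<alpha> k)\<^sup>2 *
          (real r * (\<Sum>j=1..r ^ N. truncated_moment M (X j) (\<beta> (k - 1)) (\<beta> k))
           + 2 * real r * (MAX l\<in>{1..r - 1}. \<Sum>h=0..r ^ (N - k) - 1.
              pos_part (\<Sum>(i, j)\<in>{(i, j). 1 + h * r ^ k \<le> i \<and> i < j \<and> j \<le> h * r ^ k + l * r ^ (k - 1)}.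
                G_cov M (X i) (X j) (\<beta> (k - 1))))
           + 2 * (\<Sum>h=0..r ^ (N - k) - 1.
              pos_part (\<Sum>(i, j)\<in>{(i, j). 1 + h * r ^ k \<le> i \<and> i < j \<and> j \<le> h * r ^ k + r ^ k}.
                H_cov M (X i) (X j) (\<beta> (k - 1)) (\<beta> k)))))"
    (is "_ \<le> ?exceed + ?levels")
proof -
  have [measurable]: "X j \<in> borel_measurable M" if "1 \<le> j" for j
    using X[OF that] by auto
  have \<beta>': "0 < \<beta> (k - 1)" "0 < \<beta> k" "\<beta> (k - 1) \<le> \<beta> k" if "k \<in> {1..N}" for k
    using that \<beta> by auto
  define Y where "Y k j \<omega> = trunc (\<beta> k) (X j \<omega>)" for k j \<omega>
  define Z where "Z k j \<omega> = trunc_gap (\<beta> (k - 1)) (\<beta> k) (X j \<omega>)" for k j \<omega>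
  define m2 where "m2 k j = truncated_moment M (X j) (\<beta> (k - 1)) (\<beta> k)" for k j
  define G where "G k l h = pos_part (\<Sum>(i, j)\<in>{(i, j). 1 + h * r ^ k \<le> i \<and> i < j \<and> j \<le> h * r ^ k + l * r ^ (k - 1)}.
                G_cov M (X i) (X j) (\<beta> (k - 1)))" for k l h
  define H where "H k h = pos_part (\<Sum>(i, j)\<in>{(i, j). 1 + h * r ^ k \<le> i \<and> i < j \<and> j \<le> h * r ^ k + r ^ k}.
                H_cov M (X i) (X j) (\<beta> (k - 1)) (\<beta> k))" for k h
  have Y_meas: "Y k j \<in> borel_measurable M" and Z_meas: "Z k j \<in> borel_measurable M" if "1 \<le> j" for k j
    using that unfolding Y_def[abs_def] Z_def[abs_def] by measurable
  have Y_bd: "\<bar>Y k j \<omega>\<bar> \<le> \<beta> k" if "k \<le> N" for k j \<omega>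
    unfolding Y_def by (rule abs_trunc_le[OF \<beta>(1)[OF that]])
  have Z_bd: "\<bar>Z k j \<omega>\<bar> \<le> \<beta> k" if "k \<in> {1..N}" for k j \<omega>
    unfolding Z_def by (rule abs_trunc_gap_le[OF \<beta>'(1,3)[OF that]])
  have Y_int: "integrable M (Y k j)" if "k \<le> N" "1 \<le> j" for k j
    by (rule integrable_const_bound[where B = "\<beta> k"]) (use Y_bd Y_meas that in auto)
  have Z_int: "integrable M (Z k j)" if "k \<in> {1..N}" "1 \<le> j" for k j
    by (rule integrable_const_bound[where B = "\<beta> k"]) (use Z_bd Z_meas that in auto)
  have Y_sq: "expectation (\<lambda>\<omega>. (Y (k - 1) j \<omega>)\<^sup>2) \<le> m2 k j" if "k \<in> {1..N}" "1 \<le> j" for k j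
    unfolding m2_def
  proof (rule expectation_square_le_truncated_moment)
    fix \<omega>
    show "\<bar>Y (k - 1) j \<omega>\<bar> \<le> \<bar>X j \<omega>\<bar>"
      using \<beta>'[OF that(1)] by (auto simp: Y_def trunc_def)
    show "\<bar>Y (k - 1) j \<omega>\<bar> \<le> \<beta> k"
      by (rule order_trans[OF Y_bd \<beta>'(3)[OF that(1)]]) (use that(1) in auto)
  qed (use that Y_meas \<beta>' in auto)
  have Z_sq: "expectation (\<lambda>\<omega>. (Z k j \<omega>)\<^sup>2) \<le> m2 k j" if "k \<in> {1..N}" "1 \<le> j" for k j
    unfolding m2_def
  proof (rule expectation_square_le_truncated_moment)
    fix \<omega>
    show "\<bar>Z k j \<omega>\<bar> \<le> \<bar>X j \<omega>\<bar>"
      unfolding Z_def by (rule abs_trunc_gap_le_abs[OF \<beta>'(1,3)[OF that(1)]])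
    show "\<bar>Z k j \<omega>\<bar> \<le> \<beta> k"
      by (rule Z_bd[OF that(1)])
  qed (use that Z_meas \<beta>' in auto)

  (* The three kinds of exceptional events: large variables, digit blocks, gap blocks. *)
  define A where "A j = {\<omega> \<in> space M. \<bar>X j \<omega>\<bar> > \<beta> N}" for j
  define B where "B k l h = {\<omega> \<in> space M. \<bar>\<Sum>j=1 + h * r ^ k..h * r ^ k + l * r ^ (k - 1).
      Y (k - 1) j \<omega> - expectation (Y (k - 1) j)\<bar> > \<alpha> k}" for k l h
  define C where "C k h = {\<omega> \<in> space M. \<bar>\<Sum>j=1 + h * r ^ k..h * r ^ k + r ^ k.
      Z k j \<omega> - expectation (Z k j)\<bar> > \<alpha> k}" for k h
  let ?H = "\<lambda>k. {0..r ^ (N - k) - 1}" and ?L = "{1..r - 1}"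
  have in_H: "h \<in> ?H k" if "h < r ^ (N - k)" for h k using that by auto

  have A_sets: "A j \<in> sets M" if "1 \<le> j" for j
    using that unfolding A_def by measurable
  have B_sets: "B k l h \<in> sets M" for k l h
  proof -
    have [measurable]: "(\<lambda>\<omega>. \<Sum>j=1 + h * r ^ k..h * r ^ k + l * r ^ (k - 1).
      Y (k - 1) j \<omega> - expectation (Y (k - 1) j)) \<in> borel_measurable M"
      by (intro borel_measurable_sum borel_measurable_diff Y_meas) auto
    show ?thesis unfolding B_def by measurable
  qed
  have C_sets: "C k h \<in> sets M" for k h
  proof -
    have [measurable]: "(\<lambda>\<omega>. \<Sum>j=1 + h * r ^ k..h * r ^ k + r ^ k.
      Z k j \<omega> - expectation (Z k j)) \<in> borel_measurable M"
      by (intro borel_measurable_sum borel_measurable_diff Z_meas) auto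
    show ?thesis unfolding C_def by measurable
  qed

  have B_prob: "prob (B k l h) \<le> 1 / (\<alpha> k)\<^sup>2 *
      ((\<Sum>j=1 + h * r ^ k..h * r ^ k + l * r ^ (k - 1). m2 k j) + 2 * G k l h)"
    if k: "k \<in> {1..N}" for k l h
    unfolding B_def G_def G_cov_def Y_def[symmetric, abs_def]
    by (rule chebyshev_sum_covariances[where B = "\<beta> (k - 1)"])
       (use Y_meas Y_bd Y_sq k \<alpha> in auto)
  have C_prob: "prob (C k h) \<le> 1 / (\<alpha> k)\<^sup>2 *
      ((\<Sum>j=1 + h * r ^ k..h * r ^ k + r ^ k. m2 k j) + 2 * H k h)"
    if k: "k \<in> {1..N}" for k h
    unfolding C_def H_def H_cov_def Z_def[symmetric, abs_def]
    by (rule chebyshev_sum_covariances[where B = "\<beta> k"])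
       (use Z_meas Z_bd Z_sq k \<alpha> in auto)

  have cover: "{\<omega>\<in>space M. (MAX m\<in>{1..<r ^ N}. \<bar>\<Sum>j=1..m. X j \<omega> - expectation (X j)\<bar>) > T}
      \<subseteq> (\<Union>j\<in>{1..r ^ N - 1}. A j) \<union>
        (\<Union>k\<in>{1..N}. (\<Union>l\<in>?L. \<Union>h\<in>?H k. B k l h) \<union> (\<Union>h\<in>?H k. C k h))" (is "?E \<subseteq> ?U")
  proof (rule subsetI, rule ccontr)
    fix \<omega> assume \<omega>: "\<omega> \<in> ?E" "\<omega> \<notin> ?U"
    have "\<bar>\<Sum>j=1..m. X j \<omega> - expectation (X j)\<bar> \<le> T" if m: "m \<in> {1..<r ^ N}" for m
    proof (rule order_trans[OF chaining_bound T])
      show "r > 1" "N \<ge> 1" "1 \<le> m" "m < r ^ N" using r N m by auto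
      show "\<bar>X j \<omega>\<bar> \<le> \<beta> N" if "1 \<le> j" "j < r ^ N" for j
      proof -
        have "j \<in> {1..r ^ N - 1}" using that by auto
        then have "\<omega> \<notin> A j" using \<omega>(2) by blast
        then show ?thesis using \<omega>(1) unfolding A_def by auto
      qed
      show "\<bar>\<Sum>j=1 + h * r ^ k..h * r ^ k + l * r ^ (k - 1). trunc (\<beta> (k - 1)) (X j \<omega>)
          - expectation (Y (k - 1) j)\<bar> \<le> \<alpha> k"
        if "k \<in> {1..N}" "h < r ^ (N - k)" "l \<in> {1..r - 1}" for k h l
      proof -
        have "\<omega> \<notin> B k l h" using \<omega>(2) that(1,3) in_H[OF that(2)] by blast
        then show ?thesis using \<omega>(1) unfolding B_def Y_def[symmetric] by auto
      qed
      show "\<bar>\<Sum>j=1 + h * r ^ k..h * r ^ k + r ^ k. trunc_gap (\<beta> (k - 1)) (\<beta> k) (X j \<omega>)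
          - expectation (Z k j)\<bar> \<le> \<alpha> k"
        if "k \<in> {1..N}" "h < r ^ (N - k)" for k h
      proof -
        have "\<omega> \<notin> C k h" using \<omega>(2) that(1) in_H[OF that(2)] by blast
        then show ?thesis using \<omega>(1) unfolding C_def Z_def[symmetric] by auto
      qed
      show "0 < \<alpha> k" if "k \<in> {1..N}" for k by (rule \<alpha>[OF that])
      show "\<bar>expectation (Y k j) - expectation (Y (k - 1) j)\<bar> \<le> expectation (Z k j)"
        if "k \<in> {1..N}" "1 \<le> j" for k j
      proof -
        have "expectation (Y k j) - expectation (Y (k - 1) j)
            = expectation (\<lambda>\<omega>. Y k j \<omega> - Y (k - 1) j \<omega>)"
          by (rule Bochner_Integration.integral_diff[symmetric]) (use that in \<open>auto intro!: Y_int\<close>)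
        also have "\<bar>\<dots>\<bar> \<le> expectation (Z k j)"
          unfolding Z_def[abs_def] trunc_gap_def Y_def by (rule integral_abs_bound)
        finally show ?thesis .
      qed
      show "expectation (Z k j) \<le> tail_mean M (X j) (\<beta> (k - 1))" if "k \<in> {1..N}" "1 \<le> j" for k j
      proof -
        have "\<bar>expectation (Z k j)\<bar> \<le> tail_mean M (X j) (\<beta> (k - 1))"
        proof (rule abs_expectation_le_tail_mean[OF X[OF that(2)] Z_int[OF that]])
          fix \<omega>
          have "0 \<le> Z k j \<omega>" by (simp add: Z_def trunc_gap_def)
          then show "\<bar>Z k j \<omega>\<bar> \<le> \<bar>X j \<omega>\<bar> * of_bool (\<beta> (k - 1) < \<bar>X j \<omega>\<bar>)"
            using trunc_gap_le_tail[OF \<beta>'(1,3)[OF that(1)], of "X j \<omega>"]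
            by (simp only: Z_def[symmetric] abs_of_nonneg)
        qed
        then show ?thesis by simp
      qed
      show "\<bar>expectation (Y N j) - expectation (X j)\<bar> \<le> tail_mean M (X j) (\<beta> (N - 1))" if "1 \<le> j" for j
      proof -
        have "\<bar>expectation (\<lambda>\<omega>. Y N j \<omega> - X j \<omega>)\<bar> \<le> tail_mean M (X j) (\<beta> (N - 1))"
          unfolding Y_def
          by (rule abs_expectation_le_tail_mean[OF X[OF that] _ trunc_error_le_tail])
             (use that N \<beta>' X Y_int[of N j] in \<open>auto simp: Y_def[abs_def]\<close>)
        then show ?thesis using X[OF that] Y_int[of N j] that by simp
      qed
      show "0 \<le> tail_mean M (X j) (\<beta> (k - 1))" for k j by (rule tail_mean_nonneg)
    qed
    moreover have "1 < r ^ N" by (intro one_less_power) (use r N in auto)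
    ultimately have "(MAX m\<in>{1..<r ^ N}. \<bar>\<Sum>j=1..m. X j \<omega> - expectation (X j)\<bar>) \<le> T"
      by (intro Max.boundedI) auto
    then show False using \<omega>(1) by auto
  qed

  have blocks: "(\<Sum>h\<in>?H k. \<Sum>j=1 + h * r ^ k..h * r ^ k + t. m2 k j) \<le> (\<Sum>j=1..r ^ N. m2 k j)"
    if k: "k \<in> {1..N}" and t: "t \<le> r ^ k" for k t
  proof -
    have "0 < r ^ (N - k)" using r by simp
    then have "x \<le> r ^ (N - k) - 1 \<longleftrightarrow> x < r ^ (N - k)" for x by linarith
    then have "?H k = {..<r ^ (N - k)}"
      by (intro set_eqI) (simp only: atLeastAtMost_iff lessThan_iff le0 simp_thms)
    moreover have "r ^ (N - k) * r ^ k = r ^ N" using k by (simp add: power_add[symmetric])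
    ultimately show ?thesis
      using sum_initial_segments_of_blocks_le[OF t, of "m2 k" "r ^ (N - k)"]
      by (simp add: m2_def truncated_moment_nonneg)
  qed

  have level: "prob ((\<Union>l\<in>?L. \<Union>h\<in>?H k. B k l h) \<union> (\<Union>h\<in>?H k. C k h))
      \<le> 1 / (\<alpha> k)\<^sup>2 * (real r * (\<Sum>j=1..r ^ N. m2 k j)
          + 2 * real r * (MAX l\<in>?L. \<Sum>h\<in>?H k. G k l h) + 2 * (\<Sum>h\<in>?H k. H k h))"
    if k: "k \<in> {1..N}" for k
  proof -
    let ?S = "\<Sum>j=1..r ^ N. m2 k j" and ?G = "MAX l\<in>?L. \<Sum>h\<in>?H k. G k l h"
    have G0: "0 \<le> ?G"
    proof -
      have "0 \<le> (\<Sum>h\<in>?H k. G k 1 h)" by (intro sum_nonneg) (simp add: G_def pos_part_def)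
      also have "\<dots> \<le> ?G" by (rule Max_ge) (use r in auto)
      finally show ?thesis .
    qed
    have Bl: "prob (\<Union>h\<in>?H k. B k l h) \<le> 1 / (\<alpha> k)\<^sup>2 * (?S + 2 * ?G)" if l: "l \<in> ?L" for l
    proof -
      have "prob (\<Union>h\<in>?H k. B k l h) \<le> (\<Sum>h\<in>?H k. prob (B k l h))"
        by (rule finite_measure_subadditive_finite) (use B_sets in auto)
      also have "\<dots> \<le> (\<Sum>h\<in>?H k. 1 / (\<alpha> k)\<^sup>2 *
          ((\<Sum>j=1 + h * r ^ k..h * r ^ k + l * r ^ (k - 1). m2 k j) + 2 * G k l h))"
        by (intro sum_mono B_prob k)
      also have "\<dots> = 1 / (\<alpha> k)\<^sup>2 *
          ((\<Sum>h\<in>?H k. \<Sum>j=1 + h * r ^ k..h * r ^ k + l * r ^ (k - 1). m2 k j) + 2 * (\<Sum>h\<in>?H k. G k l h))"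
        by (simp only: sum_distrib_left[symmetric] sum.distrib)
      also have "\<dots> \<le> 1 / (\<alpha> k)\<^sup>2 * (?S + 2 * ?G)"
      proof (intro mult_left_mono add_mono)
        have "l * r ^ (k - 1) \<le> r * r ^ (k - 1)" using l by (intro mult_right_mono) auto
        also have "\<dots> = r ^ k" using k by (cases k) auto
        finally show "(\<Sum>h\<in>?H k. \<Sum>j=1 + h * r ^ k..h * r ^ k + l * r ^ (k - 1). m2 k j) \<le> ?S"
          by (rule blocks[OF k])
        show "(\<Sum>h\<in>?H k. G k l h) \<le> ?G" by (rule Max_ge) (use l in auto)
      qed auto
      finally show ?thesis .
    qed
    have "prob (\<Union>l\<in>?L. \<Union>h\<in>?H k. B k l h) \<le> (\<Sum>l\<in>?L. prob (\<Union>h\<in>?H k. B k l h))"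
      by (rule finite_measure_subadditive_finite) (use B_sets in auto)
    also have "\<dots> \<le> real (card ?L) * (1 / (\<alpha> k)\<^sup>2 * (?S + 2 * ?G))"
      by (rule sum_bounded_above[OF Bl])
    finally have 1: "prob (\<Union>l\<in>?L. \<Union>h\<in>?H k. B k l h) \<le> (real r - 1) * (1 / (\<alpha> k)\<^sup>2 * (?S + 2 * ?G))"
      using r by (simp add: of_nat_diff)
    have "prob (\<Union>h\<in>?H k. C k h) \<le> (\<Sum>h\<in>?H k. prob (C k h))"
      by (rule finite_measure_subadditive_finite) (use C_sets in auto)
    also have "\<dots> \<le> (\<Sum>h\<in>?H k. 1 / (\<alpha> k)\<^sup>2 *
        ((\<Sum>j=1 + h * r ^ k..h * r ^ k + r ^ k. m2 k j) + 2 * H k h))"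
      by (intro sum_mono C_prob k)
    also have "\<dots> = 1 / (\<alpha> k)\<^sup>2 *
        ((\<Sum>h\<in>?H k. \<Sum>j=1 + h * r ^ k..h * r ^ k + r ^ k. m2 k j) + 2 * (\<Sum>h\<in>?H k. H k h))"
      by (simp only: sum_distrib_left[symmetric] sum.distrib)
    also have "\<dots> \<le> 1 / (\<alpha> k)\<^sup>2 * (?S + 2 * (\<Sum>h\<in>?H k. H k h))"
      by (intro mult_left_mono add_mono blocks k order_refl) auto
    finally have 2: "prob (\<Union>h\<in>?H k. C k h) \<le> 1 / (\<alpha> k)\<^sup>2 * (?S + 2 * (\<Sum>h\<in>?H k. H k h))" .
    have "prob ((\<Union>l\<in>?L. \<Union>h\<in>?H k. B k l h) \<union> (\<Union>h\<in>?H k. C k h))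
        \<le> prob (\<Union>l\<in>?L. \<Union>h\<in>?H k. B k l h) + prob (\<Union>h\<in>?H k. C k h)"
      by (rule measure_Un_le) (use B_sets C_sets in auto)
    also have "\<dots> \<le> (real r - 1) * (1 / (\<alpha> k)\<^sup>2 * (?S + 2 * ?G))
        + 1 / (\<alpha> k)\<^sup>2 * (?S + 2 * (\<Sum>h\<in>?H k. H k h))"
      using 1 2 by (rule add_mono)
    also have "\<dots> = 1 / (\<alpha> k)\<^sup>2 * (real r * ?S + 2 * real r * ?G + 2 * (\<Sum>h\<in>?H k. H k h)) - 1 / (\<alpha> k)\<^sup>2 * (2 * ?G)"
      by (simp only: algebra_simps)
    also have "\<dots> \<le> 1 / (\<alpha> k)\<^sup>2 * (real r * ?S + 2 * real r * ?G + 2 * (\<Sum>h\<in>?H k. H k h))"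
      using G0 by simp
    finally show ?thesis .
  qed

  have "prob ?E \<le> prob ?U"
    by (rule finite_measure_mono[OF cover])
       (use A_sets B_sets C_sets in \<open>auto intro!: sets.Un sets.finite_UN\<close>)
  also have "\<dots> \<le> prob (\<Union>j\<in>{1..r ^ N - 1}. A j)
      + prob (\<Union>k\<in>{1..N}. (\<Union>l\<in>?L. \<Union>h\<in>?H k. B k l h) \<union> (\<Union>h\<in>?H k. C k h))"
    by (rule measure_Un_le)
       (use A_sets B_sets C_sets in \<open>auto intro!: sets.Un sets.finite_UN\<close>)
  also have "\<dots> \<le> (\<Sum>j=1..r ^ N - 1. prob (A j))
      + (\<Sum>k=1..N. prob ((\<Union>l\<in>?L. \<Union>h\<in>?H k. B k l h) \<union> (\<Union>h\<in>?H k. C k h)))"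
    by (intro add_mono finite_measure_subadditive_finite)
       (use A_sets B_sets C_sets in \<open>auto intro!: sets.Un sets.finite_UN\<close>)
  also have "\<dots> \<le> ?exceed + ?levels"
    unfolding A_def using level unfolding m2_def G_def H_def
    by (intro add_mono sum_mono order_refl) auto
  finally show ?thesis .
qed

theorem theorem1:
  fixes r :: nat and \<kappa> :: real
  assumes "r > 1" and "\<kappa> > 0"
  shows "\<exists>C>0. \<forall>(M :: 'a measure) (X :: nat \<Rightarrow> 'a \<Rightarrow> real) (b :: nat \<Rightarrow> real) (a :: nat \<Rightarrow> nat \<Rightarrow> real).
    prob_space M \<longrightarrow>
    (\<forall>n\<ge>1. integrable M (X n)) \<longrightarrow>
    (\<forall>n\<ge>1. b n > 0) \<longrightarrow>
    mono_on {1..} b \<longrightarrow>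
    (\<forall>n\<ge>1. \<forall>k\<in>{1..n+1}. a n k > 0) \<longrightarrow>
    (\<forall>\<^sub>F n in at_top. norm (\<Sum>k=1..n+1. a n k) \<le> \<kappa> * norm (b (r ^ n))) \<longrightarrow>
    (\<lambda>n. \<Sum>k=1..n+1. MAX h\<in>{0..<r ^ (n + 1 - k)}. \<Sum>j=1 + h * r ^ k..h * r ^ k + r ^ k.
        LINT \<omega>|M. \<bar>X j \<omega>\<bar> * indicator {\<omega>\<in>space M. \<bar>X j \<omega>\<bar> > b (r ^ (k - 1))} \<omega>)
      \<in> o(\<lambda>n. b (r ^ n)) \<longrightarrow>
    (\<forall>\<epsilon>>0. \<exists>n\<^sub>0\<ge>1. \<forall>n\<ge>n\<^sub>0.
      \<P>(\<omega> in M. (MAX m\<in>{1..<r ^ (n + 1)}. \<bar>\<Sum>k=1..m. X k \<omega> - (LINT \<omega>'|M. X k \<omega>')\<bar>) > \<epsilon> * b (r ^ n))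
      \<le> (\<Sum>k=1..r ^ (n + 1) - 1. \<P>(\<omega> in M. \<bar>X k \<omega>\<bar> > b (r ^ (n + 1))))
        + C / \<epsilon>\<^sup>2 * (\<Sum>k=1..n+1. \<Sum>j=1..r ^ (n + 1). 1 / (a n k)\<^sup>2 *
            ((LINT \<omega>|M. (X j \<omega>)\<^sup>2 * indicator {\<omega>\<in>space M. \<bar>X j \<omega>\<bar> \<le> b (r ^ k)} \<omega>)
             + (b (r ^ k))\<^sup>2 * \<P>(\<omega> in M. \<bar>X j \<omega>\<bar> > b (r ^ (k - 1)))))
        + C / \<epsilon>\<^sup>2 * (\<Sum>k=1..n+1. 1 / (a n k)\<^sup>2 *
            (MAX l\<in>{1..r - 1}. \<Sum>h=0..r ^ (n + 1 - k) - 1.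
              pos_part (\<Sum>(i, j)\<in>{(i, j). 1 + h * r ^ k \<le> i \<and> i < j \<and> j \<le> h * r ^ k + l * r ^ (k - 1)}.
                G_cov M (X i) (X j) (b (r ^ (k - 1))))))
        + C / \<epsilon>\<^sup>2 * (\<Sum>k=1..n+1. 1 / (a n k)\<^sup>2 *
            (\<Sum>h=0..r ^ (n + 1 - k) - 1.
              pos_part (\<Sum>(i, j)\<in>{(i, j). 1 + h * r ^ k \<le> i \<and> i < j \<and> j \<le> h * r ^ k + r ^ k}.
                H_cov M (X i) (X j) (b (r ^ (k - 1))) (b (r ^ k))))))"
proof -
  (* The threshold \<epsilon> / (4\<kappa>) * a n k at scale k gives the factor 16\<kappa>\<^sup>2 in Chebyshev's inequality;
     the remaining 2r is the largest coefficient in the maximal inequality. *)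
  define C where "C = 32 * \<kappa>\<^sup>2 * real r"
  have "C > 0" using assms by (simp add: C_def)
  show ?thesis
  proof (intro exI[of _ C] conjI allI impI, goal_cases)
    case 1
    show ?case by (rule \<open>C > 0\<close>)
  next
    case (2 M X b a \<epsilon>)
    interpret prob_space M by (rule 2(1))
    note X = 2(2)[rule_format] and b = 2(3)[rule_format] and a = 2(5)[rule_format] and \<epsilon> = \<open>\<epsilon> > 0\<close>
    define W where "W n = (\<Sum>k=1..n+1. MAX h\<in>{0..<r ^ (n + 1 - k)}. \<Sum>j=1 + h * r ^ k..h * r ^ k + r ^ k.
        tail_mean M (X j) (b (r ^ (k - 1))))" for n
    have "W \<in> o(\<lambda>n. b (r ^ n))"
      unfolding W_def[abs_def] tail_mean_def by (rule 2(7))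
    then have "\<forall>\<^sub>F n in at_top. norm (W n) \<le> \<epsilon> / 6 * norm (b (r ^ n))"
      by (rule landau_o.smallD) (use \<epsilon> in simp)
    from eventually_conj[OF 2(6) this] obtain n\<^sub>0 where n\<^sub>0:
      "\<And>n. n \<ge> n\<^sub>0 \<Longrightarrow> norm (\<Sum>k=1..n+1. a n k) \<le> \<kappa> * norm (b (r ^ n))"
      "\<And>n. n \<ge> n\<^sub>0 \<Longrightarrow> norm (W n) \<le> \<epsilon> / 6 * norm (b (r ^ n))"
      unfolding eventually_at_top_linorder by blast
    show ?case
    proof (intro exI[of _ "max 1 n\<^sub>0"] conjI allI impI)
      fix n assume "max 1 n\<^sub>0 \<le> n"
      then have n: "n \<ge> 1" "n \<ge> n\<^sub>0" by auto
      define \<alpha> where "\<alpha> k = \<epsilon> / (4 * \<kappa>) * a n k" for k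
      define D where "D = 16 * \<kappa>\<^sup>2 / \<epsilon>\<^sup>2"
      have "D \<ge> 0" by (simp add: D_def)
      have CD: "C / \<epsilon>\<^sup>2 = 2 * real r * D" by (simp add: C_def D_def)
      have r1: "1 \<le> r ^ k" for k using assms(1) by simp
      have bn: "0 < b (r ^ n)" by (rule b[OF r1])
      (* Half of the level goes to the block sums, through condition (a), and half to the three
         copies of the tail means, each at most a sixth of it by condition (b). *)
      have threshold: "2 * (\<Sum>k=1..n+1. \<alpha> k) + 3 * W n \<le> \<epsilon> * b (r ^ n)"
      proof -
        have "(\<Sum>k=1..n+1. a n k) \<le> \<kappa> * b (r ^ n)" "W n \<le> \<epsilon> / 6 * b (r ^ n)"
          using n\<^sub>0[OF n(2)] bn by auto
        moreover from this(1) have "\<epsilon> / (4 * \<kappa>) * (\<Sum>k=1..n+1. a n k) \<le> \<epsilon> / (4 * \<kappa>) * (\<kappa> * b (r ^ n))"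
          by (rule mult_left_mono) (use \<epsilon> assms(2) in simp)
        moreover have "\<epsilon> / (4 * \<kappa>) * (\<kappa> * b (r ^ n)) = \<epsilon> * b (r ^ n) / 4"
          using assms(2) by simp
        ultimately show ?thesis
          unfolding \<alpha>_def sum_distrib_left[symmetric] by linarith
      qed
      have b_mono: "b (r ^ (k - 1)) \<le> b (r ^ k)" for k
        by (rule mono_onD[OF 2(4)]) (use r1 assms(1) in \<open>auto intro: power_increasing\<close>)
      have "\<P>(\<omega> in M. (MAX m\<in>{1..<r ^ (n + 1)}. \<bar>\<Sum>k=1..m. X k \<omega> - expectation (X k)\<bar>) > \<epsilon> * b (r ^ n))
        \<le> (\<Sum>j=1..r ^ (n + 1) - 1. \<P>(\<omega> in M. \<bar>X j \<omega>\<bar> > b (r ^ (n + 1))))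
        + (\<Sum>k=1..n+1. 1 / (\<alpha> k)\<^sup>2 *
          (real r * (\<Sum>j=1..r ^ (n + 1). truncated_moment M (X j) (b (r ^ (k - 1))) (b (r ^ k)))
           + 2 * real r * (MAX l\<in>{1..r - 1}. \<Sum>h=0..r ^ (n + 1 - k) - 1.
              pos_part (\<Sum>(i, j)\<in>{(i, j). 1 + h * r ^ k \<le> i \<and> i < j \<and> j \<le> h * r ^ k + l * r ^ (k - 1)}.
                G_cov M (X i) (X j) (b (r ^ (k - 1)))))
           + 2 * (\<Sum>h=0..r ^ (n + 1 - k) - 1.
              pos_part (\<Sum>(i, j)\<in>{(i, j). 1 + h * r ^ k \<le> i \<and> i < j \<and> j \<le> h * r ^ k + r ^ k}.
                H_cov M (X i) (X j) (b (r ^ (k - 1))) (b (r ^ k))))))"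
        (is "_ \<le> ?exceed + (\<Sum>k=1..n+1. 1 / (\<alpha> k)\<^sup>2 * (real r * ?S k + 2 * real r * ?G k + 2 * ?H k))")
      proof (rule multiscale_maximal_inequality[where \<beta> = "\<lambda>k. b (r ^ k)"])
        show "0 < \<alpha> k" if "k \<in> {1..n + 1}" for k
          unfolding \<alpha>_def using a[OF n(1) that] \<epsilon> assms(2) by simp
      qed (use assms(1) X b[OF r1] b_mono threshold in \<open>auto simp: W_def\<close>)
      also have "\<dots> \<le> ?exceed + (\<Sum>k=1..n+1. C / \<epsilon>\<^sup>2 * (\<Sum>j=1..r ^ (n + 1). 1 / (a n k)\<^sup>2 *
            truncated_moment M (X j) (b (r ^ (k - 1))) (b (r ^ k)))
          + C / \<epsilon>\<^sup>2 * (1 / (a n k)\<^sup>2 * ?G k) + C / \<epsilon>\<^sup>2 * (1 / (a n k)\<^sup>2 * ?H k))"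
      proof (intro add_left_mono sum_mono)
        fix k
        define q where "q = D * (1 / (a n k)\<^sup>2)"
        have q: "0 \<le> q" "1 / (\<alpha> k)\<^sup>2 = q"
          using \<open>D \<ge> 0\<close> \<epsilon> assms(2) by (auto simp: q_def \<alpha>_def D_def power_mult_distrib power_divide)
        have S0: "0 \<le> q * ?S k" using q(1) by (intro mult_nonneg_nonneg sum_nonneg truncated_moment_nonneg)
        have H0: "0 \<le> q * ?H k" using q(1)
          by (intro mult_nonneg_nonneg sum_nonneg) (auto simp: pos_part_def)
        have "real r * (q * ?S k) \<le> 2 * real r * (q * ?S k)"
          by (rule mult_right_mono[OF _ S0]) simp
        moreover have "2 * (q * ?H k) \<le> 2 * real r * (q * ?H k)"
          by (rule mult_right_mono[OF _ H0]) (use assms(1) in simp)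
        ultimately show "1 / (\<alpha> k)\<^sup>2 * (real r * ?S k + 2 * real r * ?G k + 2 * ?H k)
            \<le> C / \<epsilon>\<^sup>2 * (\<Sum>j=1..r ^ (n + 1). 1 / (a n k)\<^sup>2 *
                truncated_moment M (X j) (b (r ^ (k - 1))) (b (r ^ k)))
              + C / \<epsilon>\<^sup>2 * (1 / (a n k)\<^sup>2 * ?G k) + C / \<epsilon>\<^sup>2 * (1 / (a n k)\<^sup>2 * ?H k)"
          unfolding CD q(2) sum_distrib_left[symmetric] q_def by (simp only: algebra_simps)
      qed
      finally show "\<P>(\<omega> in M. (MAX m\<in>{1..<r ^ (n + 1)}. \<bar>\<Sum>k=1..m. X k \<omega> - expectation (X k)\<bar>) > \<epsilon> * b (r ^ n))
        \<le> ?exceed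
          + C / \<epsilon>\<^sup>2 * (\<Sum>k=1..n+1. \<Sum>j=1..r ^ (n + 1). 1 / (a n k)\<^sup>2 *
            ((LINT \<omega>|M. (X j \<omega>)\<^sup>2 * indicator {\<omega>\<in>space M. \<bar>X j \<omega>\<bar> \<le> b (r ^ k)} \<omega>)
             + (b (r ^ k))\<^sup>2 * \<P>(\<omega> in M. \<bar>X j \<omega>\<bar> > b (r ^ (k - 1)))))
          + C / \<epsilon>\<^sup>2 * (\<Sum>k=1..n+1. 1 / (a n k)\<^sup>2 * ?G k)
          + C / \<epsilon>\<^sup>2 * (\<Sum>k=1..n+1. 1 / (a n k)\<^sup>2 * ?H k)"
        by (simp only: sum.distrib sum_distrib_left[symmetric] truncated_moment_def add.assoc)
    qed simp
  qed
qed

end
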